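(* Let $k\ge 1$ be an integer and let $a,b\in\mathbb{R}$ with $b\neq 0$. Write $a\pm ib=re^{\pm i\theta}$ with $r>0$ and $\theta\in\mathbb{R}$. Let $$f_1[n]=\mathcal{Z}^{-1}\left(\frac{z}{\left(z^2-2az+(a^2+b^2)\right)^k}\right)$$ be the inverse unilateral $\mathcal{Z}$-transform. Then for every integer $n\ge 0$, $f_1[n]=f_0[n+1]$, where $$f_0[n]=\frac{2\,(-1)^{k-1}r^{n-2k}}{(2\sin\theta)^{2k-1}}\sum_{j=0}^{k-1}(-1)^j\binom{n-1}{j}\binom{n-(k+1+j)}{k-1-j}\sin\left((n-2j-1)\theta\right).$$
   Context: Unilateral $\mathcal{Z}$-transform: for a sequence $x[n]$, $n=0,1,2,\dots$, $X(z)=\mathcal{Z}(x)(z)=\sum_{n=0}^{\infty}x[n]z^{-n}$, for $|z|$ sufficiently large. The inverse $\mathcal{Z}^{-1}(X)$ of a rational function $X$ (with numerator degree at most the denominator degree) is the unique sequence $(x[n])_{n\ge 0}$ whose transform equals $X(z)$ for all $|z|$ sufficiently large. Binomial convention: for integers $\nu$ and $\kappa\ge 0$, $\binom{\nu}{\kappa}=\frac{\nu(\nu-1)\cdots(\nu-\kappa+1)}{\kappa!}$ if $\kappa\le\nu$, and $\binom{\nu}{\kappa}=0$ whenever $\kappa>\nu$ (in particular $\binom{\nu}{\kappa}=0$ for all $\nu<0$, $\kappa\ge 0$). *)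

theory Defs
  imports "HOL-Analysis.Analysis"
begin

definition has_Z_transform :: "(nat \<Rightarrow> complex) \<Rightarrow> (complex \<Rightarrow> complex) \<Rightarrow> bool" where
  "has_Z_transform x X \<longleftrightarrow> (\<forall>\<^sub>F z in at_infinity. (\<lambda>n. x n * z powi (- int n)) sums X z)"

definition inverse_Z_transform :: "(complex \<Rightarrow> complex) \<Rightarrow> nat \<Rightarrow> complex" where
  "inverse_Z_transform X = (THE x. has_Z_transform x X)"

lemma has_Z_transform_unique:
  assumes "has_Z_transform x X" and "has_Z_transform y X"
  shows "x = y"
proof -
  define d where "d n = x n - y n" for n
  have "\<forall>\<^sub>F z in at_infinity. (\<lambda>n. d n * z powi (- int n)) sums 0"
    using assms unfolding has_Z_transform_def
  proof eventually_elim
    case (elim z)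
    from sums_diff[OF this] show ?case
      by (simp add: d_def ring_distribs)
  qed
  then obtain B where B: "\<And>z. B \<le> norm z \<Longrightarrow> (\<lambda>n. d n * z powi (- int n)) sums 0"
    unfolding eventually_at_infinity by blast
  define s where "s = inverse (max B 1)"
  have s: "s > 0" by (simp add: s_def)
  have sums0: "(\<lambda>n. d n * w ^ n) sums 0" if w: "w \<noteq> 0" "norm w < s" for w :: complex
  proof -
    have "max B 1 \<le> norm (inverse w)"
      using less_imp_inverse_less[OF w(2)] w(1) unfolding s_def norm_inverse
      by (metis inverse_inverse_eq less_imp_le zero_less_norm_iff)
    with B[of "inverse w"] show ?thesis
      by (simp add: power_int_minus power_inverse)
  qed
  have d0: "d n = 0" for n
  proof (induction n rule: less_induct)
    case (less n)
    have "(\<lambda>m. d (m + n) * w ^ m) sums 0" if w: "w \<noteq> 0" "norm w < s" for w :: complex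
    proof -
      have "(\<lambda>m. d (m + n) * w ^ (m + n)) sums 0"
        using sums_split_initial_segment[OF sums0[OF w], of n] less.IH by simp
      from sums_mult2[OF this, of "inverse (w ^ n)"] show ?thesis
        using w by (simp add: power_add mult.assoc)
    qed
    then have "((\<lambda>_. 0) \<longlongrightarrow> d (0 + n)) (at (0::complex))"
      by (rule powser_limit_0_strong[OF s])
    then have "((\<lambda>_. 0) \<longlongrightarrow> d n) (at (0::complex))"
      by simp
    then show ?case
      by (simp add: tendsto_const_iff)
  qed
  then show ?thesis
    by (auto simp: d_def fun_eq_iff)
qed

lemma inverse_Z_transform_eqI:
  "has_Z_transform x X \<Longrightarrow> inverse_Z_transform X = x"
  unfolding inverse_Z_transform_def by (blast intro: has_Z_transform_unique)

text \<open>
  The binomial coefficient is zero whenever the lower index exceeds the upper one; in particular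
  it vanishes for every negative upper index, where \<^term>\<open>(gchoose)\<close> does not.
\<close>
definition binom :: "int \<Rightarrow> nat \<Rightarrow> real" where
  "binom \<nu> \<kappa> = (if int \<kappa> \<le> \<nu> then real_of_int \<nu> gchoose \<kappa> else 0)"

definition f0 :: "nat \<Rightarrow> real \<Rightarrow> real \<Rightarrow> nat \<Rightarrow> real" where
  "f0 k r \<theta> n =
     2 * (-1) ^ (k - 1) * r powi (int n - 2 * int k) / (2 * sin \<theta>) ^ (2 * k - 1) *
     (\<Sum>j = 0..k - 1. (-1) ^ j * binom (int n - 1) j * binom (int n - (int k + 1 + int j)) (k - 1 - j)
        * sin ((real n - 2 * real j - 1) * \<theta>))"

end

theory Submission
  imports Defs
begin

text \<open>
  Put \<open>x = 1/z\<close>, \<open>\<alpha> = r e\<^sup>i\<^sup>\<theta>\<close> and \<open>\<beta> = r e\<^sup>-\<^sup>i\<^sup>\<theta>\<close>. The rational function becomes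
  \<open>x ^ (2k-1) / ((1 - \<alpha>x) ^ k * (1 - \<beta>x) ^ k)\<close>, so the task is to find the Taylor coefficients
  \<open>A p q m\<close> of \<open>1 / ((1 - \<alpha>x) ^ p * (1 - \<beta>x) ^ q)\<close> for \<open>p = q = k\<close>. The usual partial fraction
  expansion leaves various powers of \<open>\<alpha> - \<beta>\<close> in the denominators; over the common denominator
  \<open>(\<alpha> - \<beta>) ^ (p+q-1)\<close> the numerator is a homogeneous polynomial in \<open>\<alpha>\<close> and \<open>\<beta>\<close> whose coefficients
  are products of just two binomial coefficients (\<open>two_pole_coeff\<close>).

  Letting the two exponents differ is what makes an induction possible.
  From \<open>\<alpha>(1 - \<beta>x) - \<beta>(1 - \<alpha>x) = \<alpha> - \<beta>\<close> one gets
  \<open>(\<alpha> - \<beta>) * A p q m = \<alpha> * A p (q-1) m - \<beta> * A (p-1) q m\<close>, and on the coefficients of the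
  numerator this recurrence is Pascal's rule (\<open>pole_part_rec\<close>). Induction reduces everything to the
  cases \<open>p = 0\<close> and \<open>q = 0\<close>, which are the negative binomial series (\<open>pole_part_single\<close>,
  \<open>sums_inverse_power\<close>).

  For \<open>p = q = k\<close> the numerator is antisymmetric in \<open>\<alpha>\<close> and \<open>\<beta>\<close>, so conjugate terms pair up to
  sines, while \<open>\<alpha> - \<beta> = 2 i r sin \<theta>\<close>: this is \<open>f0\<close> at \<open>m + 2k\<close>. The factor \<open>x ^ (2k-1)\<close> accounts
  for the shift of the index and forces the first \<open>2k - 1\<close> values to vanish, which the convention
  for binomial coefficients ensures (\<open>f0_eq_0\<close>).
\<close>

section \<open>The contribution of one pole\<close>

text \<open>
  The terms of the numerator of \<open>A p q m\<close> that come from the pole at \<open>x = 1/\<alpha>\<close>. The total degree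
  \<open>m + p + q - 1\<close> is meaningful for \<open>p + q \<ge> 1\<close> only.
\<close>
definition pole_part :: "'a::comm_ring_1 \<Rightarrow> 'a \<Rightarrow> nat \<Rightarrow> nat \<Rightarrow> nat \<Rightarrow> 'a" where
  "pole_part \<alpha> \<beta> p q m =
     (\<Sum>s<p. (-1) ^ s * of_nat (((m + p + q - 1) choose s) * ((m + p - 1 - s) choose m))
        * \<alpha> ^ (m + p + q - 1 - s) * \<beta> ^ s)"

lemma pole_part_0 [simp]: "pole_part \<alpha> \<beta> 0 q m = 0"
  by (simp add: pole_part_def)

text \<open>
  The factor \<open>(m + p - 1 - s) choose m\<close> depends only on \<open>p - s\<close>. Hence it is common to the terms in
  \<open>\<beta> ^ s\<close> of all three sums, once the last sum is shifted by the factor \<open>\<beta>\<close>; what remains is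
  Pascal's rule for the other binomial coefficient, the sign \<open>(-1) ^ s\<close> turning the difference into
  a sum.
\<close>
lemma pole_part_rec:
  "pole_part \<alpha> \<beta> (Suc p) (Suc q) m =
     \<alpha> * pole_part \<alpha> \<beta> (Suc p) q m - \<beta> * pole_part \<alpha> \<beta> p (Suc q) m"
proof -
  let ?c = "\<lambda>s. of_nat ((m + p - s) choose m) :: 'a"
  let ?M = "m + p + q"
  have powA: "\<alpha> ^ (?M - s) * \<alpha> = \<alpha> ^ (Suc ?M - s)" if "s < Suc p" for s
    using that by (simp add: Suc_diff_le power_commutes)
  have A: "\<alpha> * pole_part \<alpha> \<beta> (Suc p) q m =
      (\<Sum>s<Suc p. (-1) ^ s * of_nat (?M choose s) * ?c s * \<alpha> ^ (Suc ?M - s) * \<beta> ^ s)"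
    unfolding pole_part_def sum_distrib_left
    by (rule sum.cong) (auto simp: powA[symmetric] mult_ac)
  have B: "\<beta> * pole_part \<alpha> \<beta> p (Suc q) m =
      (\<Sum>s<p. (-1) ^ s * of_nat (?M choose s) * ?c (Suc s) * \<alpha> ^ (?M - s) * \<beta> ^ Suc s)"
    unfolding pole_part_def sum_distrib_left
    by (rule sum.cong) (auto simp: ac_simps)
  have C: "pole_part \<alpha> \<beta> (Suc p) (Suc q) m =
      (\<Sum>s<Suc p. (-1) ^ s * of_nat (Suc ?M choose s) * ?c s * \<alpha> ^ (Suc ?M - s) * \<beta> ^ s)"
    unfolding pole_part_def
    by (rule sum.cong) (auto simp: ac_simps)
  show ?thesis
    unfolding A B C
    by (simp add: sum.lessThan_Suc_shift sum.distrib sum_subtractf sum_negf algebra_simps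
        del: sum.lessThan_Suc)
qed

text \<open>
  Without a second pole, the product of the two binomial coefficients splits off a factor independent of \<open>s\<close>,
  and the rest is the binomial expansion of a power of \<open>\<alpha> - \<beta>\<close>, which cancels the common
  denominator.
\<close>
lemma pole_part_single:
  "pole_part \<alpha> \<beta> (Suc q) 0 m = of_nat ((m + q) choose m) * \<alpha> ^ m * (\<alpha> - \<beta>) ^ q"
proof -
  have choose: "((m + q) choose s) * ((m + q - s) choose m) = ((m + q) choose m) * (q choose s)"
    if "s \<le> q" for s
  proof -
    obtain t where q: "q = t + s"
      using \<open>s \<le> q\<close> by (metis le_iff_add add.commute)
    have "((t + m + s) choose (t + s)) * ((t + s) choose s)
        = ((t + m + s) choose s) * ((t + m) choose t)"
      by (rule choose_mult_lemma)
    moreover have "(t + m + s) choose (t + s) = (t + m + s) choose m"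
      using binomial_symmetric[of "t + s" "t + m + s"] by simp
    moreover have "(t + m) choose t = (t + m) choose m"
      using binomial_symmetric[of t "t + m"] by simp
    ultimately show ?thesis
      by (simp add: q ac_simps)
  qed
  have "pole_part \<alpha> \<beta> (Suc q) 0 m =
     (\<Sum>s\<le>q. of_nat ((m + q) choose m) * \<alpha> ^ m * (of_nat (q choose s) * (-\<beta>) ^ s * \<alpha> ^ (q - s)))"
    unfolding pole_part_def lessThan_Suc_atMost
  proof (rule sum.cong)
    fix s assume "s \<in> {..q}"
    then have s: "s \<le> q" by simp
    have "\<alpha> ^ (m + q - s) = \<alpha> ^ m * \<alpha> ^ (q - s)"
      using s by (simp flip: power_add)
    moreover have "(-\<beta>) ^ s = (-1) ^ s * \<beta> ^ s"
      by (rule power_minus)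
    ultimately show "(-1) ^ s * of_nat ((m + Suc q + 0 - 1 choose s) * (m + Suc q - 1 - s choose m))
         * \<alpha> ^ (m + Suc q + 0 - 1 - s) * \<beta> ^ s
       = of_nat ((m + q) choose m) * \<alpha> ^ m * (of_nat (q choose s) * (-\<beta>) ^ s * \<alpha> ^ (q - s))"
      using choose[OF s] by (simp add: ac_simps del: of_nat_mult) (simp add: ac_simps)
  qed simp
  also have "\<dots> = of_nat ((m + q) choose m) * \<alpha> ^ m * (-\<beta> + \<alpha>) ^ q"
    unfolding sum_distrib_left[symmetric] binomial_ring ..
  finally show ?thesis by simp
qed

section \<open>Power series with two poles\<close>

lemma sums_inverse_power:
  fixes y :: complex
  assumes "norm y < 1"
  shows "(\<lambda>m. of_nat ((m + q) choose m) * y ^ m) sums (1 / (1 - y) ^ Suc q)"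
proof -
  have "(\<lambda>m. ((- of_nat (Suc q)) gchoose m) * (-y) ^ m) sums (1 + (-y)) powr (- of_nat (Suc q))"
    using assms by (intro gen_binomial_complex) simp
  moreover have "((- of_nat (Suc q)) gchoose m) * (-y) ^ m = of_nat ((m + q) choose m) * y ^ m" for m
  proof -
    have "of_nat (Suc q) + of_nat m - 1 = (of_nat (m + q) :: complex)"
      by simp
    then show ?thesis
      by (simp only: gbinomial_minus binomial_gbinomial power_minus[of y]) simp
  qed
  moreover have "1 - y \<noteq> 0"
    using assms by auto
  then have "(1 - y) powr of_nat (Suc q) = (1 - y) ^ Suc q"
    by (intro powr_nat') simp
  then have "(1 + (-y)) powr (- of_nat (Suc q)) = 1 / (1 - y) ^ Suc q"
    by (simp add: powr_minus inverse_eq_divide del: of_nat_Suc power_Suc)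
  ultimately show ?thesis
    by simp
qed

text \<open>
  Exchanging the poles turns \<open>(\<alpha> - \<beta>) ^ (p+q-1)\<close> into \<open>(\<beta> - \<alpha>) ^ (p+q-1)\<close>; the sign in front of
  the second part brings both parts over the same denominator.
\<close>
definition two_pole_coeff :: "complex \<Rightarrow> complex \<Rightarrow> nat \<Rightarrow> nat \<Rightarrow> nat \<Rightarrow> complex" where
  "two_pole_coeff \<alpha> \<beta> p q m =
     (pole_part \<alpha> \<beta> p q m + (-1) ^ (p + q - 1) * pole_part \<beta> \<alpha> q p m) / (\<alpha> - \<beta>) ^ (p + q - 1)"

lemma two_pole_coeff_rec:
  assumes "\<alpha> \<noteq> \<beta>"
  shows "two_pole_coeff \<alpha> \<beta> (Suc p) (Suc q) m =
    (\<alpha> * two_pole_coeff \<alpha> \<beta> (Suc p) q m - \<beta> * two_pole_coeff \<alpha> \<beta> p (Suc q) m) / (\<alpha> - \<beta>)"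
  using assms unfolding two_pole_coeff_def pole_part_rec
  by (simp add: field_simps)

text \<open>
  In a double induction on the exponents, the step from \<open>(p+1, q)\<close> and \<open>(p, q+1)\<close> to
  \<open>(p+1, q+1)\<close> never passes through \<open>(0, 0)\<close>, where the closed form gives 0 instead of the constant series 1.
\<close>
lemma sums_two_pole_coeff:
  assumes "\<alpha> \<noteq> \<beta>" "norm (\<alpha> * x) < 1" "norm (\<beta> * x) < 1" "p + q \<ge> 1"
  shows "(\<lambda>m. two_pole_coeff \<alpha> \<beta> p q m * x ^ m) sums (1 / ((1 - \<alpha> * x) ^ p * (1 - \<beta> * x) ^ q))"
  using \<open>p + q \<ge> 1\<close>
proof (induction p arbitrary: q)
  case 0
  then obtain q' where q: "q = Suc q'"
    by (cases q) auto
  have "(-1) ^ q' * (\<beta> - \<alpha>) ^ q' = (\<alpha> - \<beta>) ^ q'"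
    by (simp flip: power_mult_distrib)
  then have "two_pole_coeff \<alpha> \<beta> 0 q m = of_nat ((m + q') choose m) * \<beta> ^ m" for m
    using assms(1) by (simp add: two_pole_coeff_def q pole_part_single field_simps)
  then show ?case
    using sums_inverse_power[OF assms(3), of q'] by (simp add: q power_mult_distrib mult.assoc)
next
  case (Suc p)
  note IHp = Suc.IH
  show ?case
  proof (induction q)
    case 0
    have "two_pole_coeff \<alpha> \<beta> (Suc p) 0 m = of_nat ((m + p) choose m) * \<alpha> ^ m" for m
      using assms(1) by (simp add: two_pole_coeff_def pole_part_single)
    then show ?case
      using sums_inverse_power[OF assms(2), of p] by (simp add: power_mult_distrib mult.assoc)
  next
    case (Suc q)
    let ?u = "1 - \<alpha> * x" and ?v = "1 - \<beta> * x"
    have nz: "?u \<noteq> 0" "?v \<noteq> 0"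
      using assms(2,3) by auto
    have "\<alpha> \<noteq> \<beta>" by fact
    have "(\<lambda>m. two_pole_coeff \<alpha> \<beta> (Suc p) q m * x ^ m) sums (1 / (?u ^ Suc p * ?v ^ q))"
      using Suc.IH by simp
    moreover have "(\<lambda>m. two_pole_coeff \<alpha> \<beta> p (Suc q) m * x ^ m) sums (1 / (?u ^ p * ?v ^ Suc q))"
      using IHp[of "Suc q"] by simp
    ultimately have "(\<lambda>m. (\<alpha> * (two_pole_coeff \<alpha> \<beta> (Suc p) q m * x ^ m)
        - \<beta> * (two_pole_coeff \<alpha> \<beta> p (Suc q) m * x ^ m)) / (\<alpha> - \<beta>))
      sums ((\<alpha> * (1 / (?u ^ Suc p * ?v ^ q)) - \<beta> * (1 / (?u ^ p * ?v ^ Suc q))) / (\<alpha> - \<beta>))"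
      by (intro sums_divide sums_diff sums_mult)
    moreover have "(\<alpha> * (1 / (?u ^ Suc p * ?v ^ q)) - \<beta> * (1 / (?u ^ p * ?v ^ Suc q))) / (\<alpha> - \<beta>)
        = 1 / (?u ^ Suc p * ?v ^ Suc q)"
    proof -
      have "\<alpha> * (1 / (?u ^ Suc p * ?v ^ q)) - \<beta> * (1 / (?u ^ p * ?v ^ Suc q))
          = (\<alpha> * ?v - \<beta> * ?u) / (?u ^ Suc p * ?v ^ Suc q)"
        using nz by (simp add: diff_divide_distrib)
      also have "\<alpha> * ?v - \<beta> * ?u = \<alpha> - \<beta>"
        by (simp add: algebra_simps)
      finally show ?thesis
        using \<open>\<alpha> \<noteq> \<beta>\<close> by simp
    qed
    ultimately show ?case
      using two_pole_coeff_rec[OF \<open>\<alpha> \<noteq> \<beta>\<close>] by (simp add: left_diff_distrib mult.assoc)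
  qed
qed

section \<open>The sine sum as a series coefficient\<close>

lemma binom_of_nat: "binom (int n) j = of_nat (n choose j)"
  by (simp add: binom_def binomial_gbinomial[symmetric] binomial_eq_0)

text \<open>
  Every summand vanishes, because the upper index \<open>n - k - 1 - j\<close> of the second binomial coefficient
  is below the lower index \<open>k - 1 - j\<close> exactly when \<open>n < 2k\<close>, whatever \<open>j\<close> is.
\<close>
lemma f0_eq_0:
  assumes "k \<ge> 1" "n < 2 * k"
  shows "f0 k r \<theta> n = 0"
proof -
  have "binom (int n - (int k + 1 + int j)) (k - 1 - j) = 0" if "j \<in> {0..k - 1}" for j
    using that assms by (auto simp: binom_def of_nat_diff)
  then show ?thesis
    by (simp add: f0_def)
qed

text \<open>
  With \<open>M = m + 2k - 1\<close>, the powers of \<open>r\<close> and the constants match because the numerator is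
  \<open>2 i r ^ M\<close> times a real sum and the denominator is an odd power of \<open>2 i r sin \<theta>\<close>, so that the
  factors \<open>i\<close> cancel up to the sign \<open>(-1) ^ (k-1)\<close>.
\<close>
lemma f0_eq_two_pole_coeff:
  assumes "k \<ge> 1" "r > 0" "sin \<theta> \<noteq> 0"
  shows "complex_of_real (f0 k r \<theta> (m + 2 * k)) = two_pole_coeff (rcis r \<theta>) (rcis r (- \<theta>)) k k m"
proof -
  let ?\<alpha> = "rcis r \<theta>" and ?\<beta> = "rcis r (- \<theta>)"
  let ?c = "\<lambda>s. (-1) ^ s * of_nat (((m + k + k - 1) choose s) * ((m + k - 1 - s) choose m)) :: real"
  obtain l where k: "k = Suc l"
    using assms(1) by (cases k) auto
  define M where "M = m + 2 * l + 1"
  define S where "S = (\<Sum>s<k. ?c s * sin ((real M - 2 * real s) * \<theta>))"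
  have M: "m + k + k - 1 = M" and odd: "(-1 :: complex) ^ (k + k - 1) = -1"
    by (simp_all add: k M_def)
  have monomial: "?\<alpha> ^ (M - s) * ?\<beta> ^ s - ?\<beta> ^ (M - s) * ?\<alpha> ^ s
      = 2 * \<i> * of_real (r ^ M * sin ((real M - 2 * real s) * \<theta>))" if "s \<le> M" for s
  proof -
    have r: "r ^ (M - s) * r ^ s = r ^ M" "r ^ s * r ^ (M - s) = r ^ M"
      using that by (simp_all flip: power_add)
    have angle: "real (M - s) * \<theta> - real s * \<theta> = (real M - 2 * real s) * \<theta>"
      "real s * \<theta> - real (M - s) * \<theta> = - ((real M - 2 * real s) * \<theta>)"
      using that by (simp_all add: of_nat_diff algebra_simps)
    have "?\<alpha> ^ (M - s) * ?\<beta> ^ s = rcis (r ^ M) ((real M - 2 * real s) * \<theta>)"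
      "?\<beta> ^ (M - s) * ?\<alpha> ^ s = rcis (r ^ M) (- ((real M - 2 * real s) * \<theta>))"
      by (simp_all add: DeMoivre2 rcis_mult r angle)
    then show ?thesis
      by (simp add: complex_eq_iff)
  qed
  have "pole_part ?\<alpha> ?\<beta> k k m + (-1) ^ (k + k - 1) * pole_part ?\<beta> ?\<alpha> k k m
     = (\<Sum>s<k. of_real (?c s) * (?\<alpha> ^ (M - s) * ?\<beta> ^ s - ?\<beta> ^ (M - s) * ?\<alpha> ^ s))"
    unfolding pole_part_def M odd
    by (simp add: algebra_simps sum_subtractf)
  also have "\<dots> = (\<Sum>s<k. 2 * \<i> * of_real (r ^ M * (?c s * sin ((real M - 2 * real s) * \<theta>))))"
  proof (rule sum.cong)
    fix s assume "s \<in> {..<k}"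
    then have "s \<le> M"
      by (simp add: k M_def)
    then show "of_real (?c s) * (?\<alpha> ^ (M - s) * ?\<beta> ^ s - ?\<beta> ^ (M - s) * ?\<alpha> ^ s)
        = 2 * \<i> * of_real (r ^ M * (?c s * sin ((real M - 2 * real s) * \<theta>)))"
      by (simp only: monomial) simp
  qed simp
  finally have num: "pole_part ?\<alpha> ?\<beta> k k m + (-1) ^ (k + k - 1) * pole_part ?\<beta> ?\<alpha> k k m
     = 2 * \<i> * of_real (r ^ M * S)"
    by (simp add: S_def sum_distrib_left)
  have "?\<alpha> - ?\<beta> = \<i> * of_real (2 * r * sin \<theta>)"
    by (simp add: complex_eq_iff)
  moreover have "(\<i> * of_real y) ^ (2 * l + 1) = \<i> * of_real ((-1) ^ l * y ^ (2 * l + 1))" for y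
    by (simp add: power_mult_distrib power_mult[of \<i>])
  moreover have "k + k - 1 = 2 * l + 1"
    by (simp add: k)
  ultimately have den: "(?\<alpha> - ?\<beta>) ^ (k + k - 1)
      = \<i> * of_real ((-1) ^ l * r ^ (2 * l + 1) * (2 * sin \<theta>) ^ (2 * l + 1))"
    by (simp only:) (simp add: power_mult_distrib)
  have "f0 k r \<theta> (m + 2 * k) = 2 * (-1) ^ l * r ^ m / (2 * sin \<theta>) ^ (2 * l + 1)
      * S"
  proof -
    have binoms: "binom (int (m + 2 * k) - 1) j * binom (int (m + 2 * k) - (int k + 1 + int j)) (k - 1 - j)
        = of_nat (((m + k + k - 1) choose j) * ((m + k - 1 - j) choose m))" if "j \<le> l" for j
    proof -
      have "int (m + 2 * k) - 1 = int (m + k + k - 1)"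
        "int (m + 2 * k) - (int k + 1 + int j) = int (m + k - 1 - j)"
        using that by (auto simp: k of_nat_diff)
      moreover have "(m + k - 1 - j) choose (k - 1 - j) = (m + k - 1 - j) choose m"
        using that binomial_symmetric[of m "m + l - j"] by (simp add: k)
      ultimately show ?thesis
        by (simp only: binom_of_nat of_nat_mult)
    qed
    have angle: "real (m + 2 * k) - 2 * real j - 1 = real M - 2 * real j" for j
      by (simp add: k M_def)
    have "(\<Sum>j = 0..k - 1. (-1) ^ j * binom (int (m + 2 * k) - 1) j
          * binom (int (m + 2 * k) - (int k + 1 + int j)) (k - 1 - j)
          * sin ((real (m + 2 * k) - 2 * real j - 1) * \<theta>))
        = S"
      unfolding S_def
    proof (rule sum.cong)
      fix j assume "j \<in> {..<k}"
      then have "j \<le> l"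
        by (simp add: k)
      then show "(-1) ^ j * binom (int (m + 2 * k) - 1) j
          * binom (int (m + 2 * k) - (int k + 1 + int j)) (k - 1 - j)
          * sin ((real (m + 2 * k) - 2 * real j - 1) * \<theta>)
        = ?c j * sin ((real M - 2 * real j) * \<theta>)"
        unfolding angle mult.assoc[of "(-1) ^ j" "binom _ _"] by (simp only: binoms)
    qed (auto simp: k)
    moreover have "r powi (int (m + 2 * k) - 2 * int k) = r ^ m"
      by simp
    moreover have "k - 1 = l" "2 * k - 1 = 2 * l + 1"
      by (simp_all add: k)
    ultimately show ?thesis
      unfolding f0_def by (simp only:)
  qed
  also have "\<dots> = 2 * (r ^ M * S) / ((-1) ^ l * r ^ (2 * l + 1) * (2 * sin \<theta>) ^ (2 * l + 1))"
  proof -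
    have "r ^ M = r ^ m * r ^ (2 * l + 1)"
      unfolding M_def by (simp only: power_add mult.assoc)
    moreover have "r ^ (2 * l + 1) \<noteq> 0"
      using \<open>r > 0\<close> by simp
    moreover have "2 * e * x / d * S = 2 * (x * y * S) / (e * y * d)"
      if "y \<noteq> 0" "e = 1 \<or> e = -1" for d e x y :: real
      using that by auto
    moreover have "(-1 :: real) ^ l = 1 \<or> (-1 :: real) ^ l = -1"
      by (cases "even l") auto
    ultimately show ?thesis
      by (simp only:)
  qed
  finally show ?thesis
    unfolding two_pole_coeff_def num den by simp
qed

theorem corollary3p4:
  fixes k :: nat and a b r \<theta> :: real
  assumes "k \<ge> 1" and "b \<noteq> 0" and "r > 0"
    and "complex_of_real a + \<i> * complex_of_real b = complex_of_real r * exp (\<i> * complex_of_real \<theta>)"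
    and "complex_of_real a - \<i> * complex_of_real b = complex_of_real r * exp (- \<i> * complex_of_real \<theta>)"
  shows "\<forall>n::nat.
    inverse_Z_transform
      (\<lambda>z. z / (z\<^sup>2 - 2 * complex_of_real a * z + complex_of_real (a\<^sup>2 + b\<^sup>2)) ^ k) n
    = complex_of_real (f0 k r \<theta> (n + 1))"
proof -
  let ?\<alpha> = "rcis r \<theta>" and ?\<beta> = "rcis r (- \<theta>)"
  let ?X = "\<lambda>z. z / (z\<^sup>2 - 2 * complex_of_real a * z + complex_of_real (a\<^sup>2 + b\<^sup>2)) ^ k"
  let ?f = "\<lambda>n. complex_of_real (f0 k r \<theta> (n + 1))"
  have \<alpha>: "?\<alpha> = complex_of_real a + \<i> * complex_of_real b"
    using assms(4) by (simp add: rcis_def cis_conv_exp)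
  have \<beta>: "?\<beta> = complex_of_real a - \<i> * complex_of_real b"
    using assms(5) by (simp add: rcis_def cis_conv_exp)
  have "b = r * sin \<theta>"
    using arg_cong[OF \<alpha>, of Im] by simp
  then have "sin \<theta> \<noteq> 0"
    using \<open>b \<noteq> 0\<close> by auto
  have "?\<alpha> \<noteq> ?\<beta>"
    unfolding \<alpha> \<beta> using \<open>b \<noteq> 0\<close> by (simp add: complex_eq_iff)
  have "(\<lambda>n. ?f n * z powi (- int n)) sums ?X z" if "r + 1 \<le> norm z" for z
  proof -
    define x where "x = inverse z"
    have "z \<noteq> 0" "norm z > r"
      using that \<open>r > 0\<close> by auto
    then have "norm (?\<alpha> * x) < 1" "norm (?\<beta> * x) < 1"
      using \<open>r > 0\<close> by (auto simp: x_def norm_mult norm_inverse norm_divide divide_simps)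
    with \<open>?\<alpha> \<noteq> ?\<beta>\<close> \<open>k \<ge> 1\<close> have "(\<lambda>m. two_pole_coeff ?\<alpha> ?\<beta> k k m * x ^ m) sums
        (1 / ((1 - ?\<alpha> * x) ^ k * (1 - ?\<beta> * x) ^ k))"
      by (intro sums_two_pole_coeff) auto
    then have "(\<lambda>m. two_pole_coeff ?\<alpha> ?\<beta> k k m * x ^ m * x ^ (2 * k - 1)) sums
        (1 / ((1 - ?\<alpha> * x) ^ k * (1 - ?\<beta> * x) ^ k) * x ^ (2 * k - 1))"
      by (rule sums_mult2)
    moreover have "two_pole_coeff ?\<alpha> ?\<beta> k k m = ?f (m + (2 * k - 1))" for m
      using f0_eq_two_pole_coeff[OF \<open>k \<ge> 1\<close> \<open>r > 0\<close> \<open>sin \<theta> \<noteq> 0\<close>, of m] \<open>k \<ge> 1\<close> by simp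
    ultimately have "(\<lambda>m. ?f (m + (2 * k - 1)) * x ^ (m + (2 * k - 1))) sums
        (1 / ((1 - ?\<alpha> * x) ^ k * (1 - ?\<beta> * x) ^ k) * x ^ (2 * k - 1))"
      by (simp add: power_add mult.assoc)
    \<comment> \<open>The series above starts at index \<open>2k - 1\<close>; the missing initial terms are zero.\<close>
    moreover have "?f i * x ^ i = 0" if "i < 2 * k - 1" for i
      using f0_eq_0[OF \<open>k \<ge> 1\<close>, of "i + 1" r \<theta>] that by simp
    ultimately have "(\<lambda>n. ?f n * x ^ n) sums
        (1 / ((1 - ?\<alpha> * x) ^ k * (1 - ?\<beta> * x) ^ k) * x ^ (2 * k - 1))"
      using sums_zero_iff_shift[of "2 * k - 1" "\<lambda>n. ?f n * x ^ n"] by blast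
    moreover have "1 / ((1 - ?\<alpha> * x) ^ k * (1 - ?\<beta> * x) ^ k) * x ^ (2 * k - 1) = ?X z"
    proof -
      have "z\<^sup>2 - 2 * complex_of_real a * z + complex_of_real (a\<^sup>2 + b\<^sup>2) = (z - ?\<alpha>) * (z - ?\<beta>)"
        unfolding \<alpha> \<beta> by (simp add: algebra_simps power2_eq_square)
      also have "\<dots> = z\<^sup>2 * ((1 - ?\<alpha> * x) * (1 - ?\<beta> * x))"
        using \<open>z \<noteq> 0\<close> by (simp add: x_def field_simps power2_eq_square)
      finally have "?X z = z / (z ^ (2 * k)) * (1 / ((1 - ?\<alpha> * x) ^ k * (1 - ?\<beta> * x) ^ k))"
        by (simp add: power_mult_distrib power_mult)
      moreover have "z / z ^ (2 * k) = x ^ (2 * k - 1)"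
        using \<open>z \<noteq> 0\<close> \<open>k \<ge> 1\<close> by (cases k) (auto simp: x_def field_simps)
      ultimately show ?thesis
        by simp
    qed
    ultimately show ?thesis
      by (simp add: x_def power_int_minus power_inverse)
  qed
  then have "has_Z_transform ?f ?X"
    unfolding has_Z_transform_def eventually_at_infinity by blast
  then show ?thesis
    by (simp add: inverse_Z_transform_eqI)
qed

end
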